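(* Let $a,b\in\mathbb{R}$ satisfy $-1<b<1-|a|$, and let $0<p<2$ and $r\ge p$. Let $\theta$ be a real random variable and let $(\theta_k)_{k\ge1}$ be a sequence of independent copies of $\theta$ defined on a common probability space $(\Omega,\mathcal{F},\mathbb{P})$. Define $(\xi_k)_{k\ge -1}$ by $\xi_{-1}=0$, $\xi_0=0$, and $\xi_k=a\xi_{k-1}+b\xi_{k-2}+\theta_k$ for $k\ge1$, and set $S_n=\sum_{k=1}^n\xi_k$ for $n\ge1$. If $\mathbb{E}|\theta|^r<\infty$, and moreover $\mathbb{E}\theta=0$ whenever $r\ge1$, then for every $\varepsilon>0$, $$\sum_{n=1}^\infty n^{\frac{r}{p}-2}\,\mathbb{P}\left\{\frac{|S_n|}{n^{1/p}}>\varepsilon\right\}<\infty.$$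
   Context: "Independent copies of $\theta$" means that the random variables $\theta_k$, $k\ge1$, are mutually independent and each has the same distribution as $\theta$. The sequence $(\xi_k)$ is called a linear 2-nd order autoregressive sequence with constant real coefficients $a,b$. The exponents $p$ and $r$ are real numbers. *)

theory Defs
  imports "HOL-Probability.Probability"
begin

end

theory Submission
  imports Defs "HOL-Real_Asymp.Real_Asymp"
begin

text \<open>
  The partial sum is a weighted sum \<open>S\<^sub>n = (\<Sum>k=1..n. w\<^sub>n\<^sub>-\<^sub>k \<theta>\<^sub>k)\<close> whose weights, the step response of the
  recursion, are bounded because the companion matrix is stable. It therefore suffices to prove the
  Baum--Katz theorem for uniformly bounded weights. Truncating \<open>\<theta>\<^sub>k\<close> at \<open>\<delta> n^(1/p)\<close>, the event that some
  term is truncated is controlled by the moment of order \<open>r\<close>, and the truncated means are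
  \<open>o(n^(1/p - 1))\<close> by dominated convergence. The truncated sums are then
  handled by Chebyshev's inequality if \<open>r < 2\<close>, and by an exponential Markov inequality if
  \<open>r \<ge> 2\<close>.
\<close>

subsection \<open>Truncation and moments\<close>

lemma sum_powr_less_bound:
  fixes t Z :: real
  assumes "0 \<le> t" "0 \<le> Z"
  shows "(\<Sum>n<N. real n powr t * (if real n < Z then 1 else 0)) \<le> Z powr (t + 1)"
proof -
  \<comment> \<open>Index 0 may be dropped because \<open>0 powr t = 0\<close>. At most
    \<open>Z\<close> positive integers lie below \<open>Z\<close>, and each contributes at most
    \<open>Z powr t\<close>.\<close>
  let ?A = "{n\<in>{..<N}. 0 < n \<and> real n < Z}"
  have card: "real (card ?A) \<le> Z"
  proof -
    have "?A \<subseteq> {1..nat \<lfloor>Z\<rfloor>}" by (auto simp: le_nat_floor)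
    then have "card ?A \<le> nat \<lfloor>Z\<rfloor>" using card_mono[of "{1..nat \<lfloor>Z\<rfloor>}" ?A] by simp
    then show ?thesis using assms(2) by linarith
  qed
  have "(\<Sum>n<N. real n powr t * (if real n < Z then 1 else 0)) = (\<Sum>n\<in>?A. real n powr t)"
    by (rule sum.mono_neutral_cong_right) auto
  also have "\<dots> \<le> (\<Sum>n\<in>?A. Z powr t)"
    using assms by (intro sum_mono powr_mono2) auto
  also have "\<dots> = real (card ?A) * Z powr t" by simp
  also have "\<dots> \<le> Z * Z powr t"
    using card by (intro mult_right_mono) auto
  also have "\<dots> = Z powr (t + 1)"
    using assms by (simp add: powr_mult_base add.commute)
  finally show ?thesis .
qed

text \<open>The mean value theorem on [x, x + 1] gives a derivative at some z < x + 1 \<le> 2 * x,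
  and passing from z to 2 * x costs the factor \<open>2 powr (k + 1)\<close>. The right-hand side
  telescopes, which takes the place of comparing a sum with an integral.\<close>

lemma powr_diff_telescope:
  fixes k x :: real
  assumes "0 < k" "1 \<le> x"
  shows "x powr (- k - 1) \<le> (2 powr (k + 1) / k) * (x powr (- k) - (x + 1) powr (- k))"
proof -
  have "\<exists>z>x. z < x + 1 \<and> (x + 1) powr (- k) - x powr (- k) = (x + 1 - x) * (- k * z powr (- k - 1))"
    using assms by (intro MVT2) (auto intro!: derivative_eq_intros)
  then obtain z where z: "x < z" "z < x + 1"
    and eq: "x powr (- k) - (x + 1) powr (- k) = k * z powr (- k - 1)" by auto
  have "(2 * x) powr (- k - 1) \<le> z powr (- k - 1)"
    using assms z by (intro powr_mono2') auto
  then have "2 powr (k + 1) * (2 powr (- k - 1) * x powr (- k - 1)) \<le> 2 powr (k + 1) * z powr (- k - 1)"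
    using assms by (simp add: powr_mult)
  moreover have "2 powr (k + 1) * 2 powr (- k - 1) = (1::real)"
    by (simp flip: powr_add)
  ultimately have "x powr (- k - 1) \<le> 2 powr (k + 1) * z powr (- k - 1)"
    by (metis mult.assoc mult_1)
  then show ?thesis using assms eq by simp
qed

lemma sum_powr_ge_bound:
  fixes k Z :: real
  assumes "0 < k" "0 < Z"
  shows "(\<Sum>n<N. real n powr (- k - 1) * (if Z \<le> real n then 1 else 0))
    \<le> (2 powr (k + 1) / k) * Z powr (- k)"
proof -
  define K where "K = 2 powr (k + 1) / k"
  have K: "0 \<le> K" using assms by (simp add: K_def)
  \<comment> \<open>Capping at \<open>Z powr (- k)\<close> starts the telescoping at the threshold
    \<open>Z\<close>. The special value at 0 is there because \<open>0 powr (- k) = 0\<close> would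
    make \<open>g\<close> increase at its first step.\<close>
  define g where "g n = min (Z powr (- k)) ((if n = 0 then Z else real n) powr (- k))" for n :: nat
  have step: "real n powr (- k - 1) * (if Z \<le> real n then 1 else 0) \<le> K * (g n - g (Suc n))" for n
  proof (cases "n = 0")
    case True
    then show ?thesis using K by (simp add: g_def)
  next
    case False
    then have n: "1 \<le> real n" by simp
    have mono: "(real n + 1) powr (- k) \<le> real n powr (- k)"
      using n assms by (intro powr_mono2') auto
    show ?thesis
    proof (cases "Z \<le> real n")
      case True
      then have "real n powr (- k) \<le> Z powr (- k)"
        using assms by (intro powr_mono2') auto
      then have "g n - g (Suc n) = real n powr (- k) - (real n + 1) powr (- k)"
        using False mono by (simp add: g_def add.commute min_def)
      then show ?thesis
        using True powr_diff_telescope[OF assms(1) n] by (simp add: K_def)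
    next
      case False2: False
      have "0 \<le> g n - g (Suc n)"
        using False mono by (simp add: g_def add.commute min_def)
      then show ?thesis using False2 K by simp
    qed
  qed
  have "(\<Sum>n<N. real n powr (- k - 1) * (if Z \<le> real n then 1 else 0)) \<le> (\<Sum>n<N. K * (g n - g (Suc n)))"
    by (intro sum_mono step)
  also have "\<dots> = K * (g 0 - g N)"
    by (simp add: sum_lessThan_telescope' flip: sum_distrib_left)
  also have "\<dots> \<le> K * Z powr (- k)"
    using K by (intro mult_left_mono) (auto simp: g_def)
  finally show ?thesis by (simp add: K_def)
qed

section \<open>Series controlled by a moment\<close>

lemma summable_integral_bound:
  fixes f :: "nat \<Rightarrow> 'a \<Rightarrow> real"
  assumes f: "\<And>n. integrable M (f n)" "\<And>n. 0 \<le> (\<integral>x. f n x \<partial>M)"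
    and g: "integrable M g"
    and le: "\<And>N x. (\<Sum>n<N. f n x) \<le> g x"
  shows "summable (\<lambda>n. \<integral>x. f n x \<partial>M)"
proof (rule summableI_nonneg_bounded)
  show "(\<Sum>n<N. \<integral>x. f n x \<partial>M) \<le> (\<integral>x. g x \<partial>M)" for N
  proof -
    have "(\<Sum>n<N. \<integral>x. f n x \<partial>M) = (\<integral>x. (\<Sum>n<N. f n x) \<partial>M)"
      using f by (subst Bochner_Integration.integral_sum) auto
    also have "\<dots> \<le> (\<integral>x. g x \<partial>M)"
      using f g le by (intro integral_mono) auto
    finally show ?thesis .
  qed
qed (rule f)

text \<open>For fixed \<open>x\<close> this turns the truncation condition into a threshold on the
  index \<open>n\<close>, the form in which the power sums apply.\<close>

lemma less_powr_inverse_iff: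
  fixes x d p :: real
  assumes "0 < d" "0 < p"
  shows "d * real n powr (1 / p) < \<bar>x\<bar> \<longleftrightarrow> real n < (\<bar>x\<bar> / d) powr p"
proof -
  have "d * real n powr (1 / p) < \<bar>x\<bar> \<longleftrightarrow> real n powr (1 / p) < \<bar>x\<bar> / d"
    using assms by (simp add: field_simps)
  also have "\<dots> \<longleftrightarrow> (real n powr (1 / p)) powr p < (\<bar>x\<bar> / d) powr p"
  proof
    assume "(real n powr (1 / p)) powr p < (\<bar>x\<bar> / d) powr p"
    then show "real n powr (1 / p) < \<bar>x\<bar> / d"
      using assms by (metis abs_ge_zero divide_nonneg_pos not_less powr_ge_zero powr_mono2 less_imp_le)
  qed (use assms in \<open>auto intro!: powr_less_mono2\<close>)
  finally show ?thesis using assms by (simp add: powr_powr)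
qed

text \<open>For fixed x only the indices n < (|x| / d)^p count, and their weights add up to at most
  (|x| / d)^r. The exponent exceeds that of the theorem by one because a union bound over n
  variables contributes a factor n.\<close>

lemma summable_tail_prob:
  fixes D :: "real measure"
  assumes D: "prob_space D" "sets D = sets borel"
    and p: "0 < p" "p \<le> r" and d: "0 < d"
    and int: "integrable D (\<lambda>x. \<bar>x\<bar> powr r)"
  shows "summable (\<lambda>n. real n powr (r / p - 1) * measure D {x. d * real n powr (1 / p) < \<bar>x\<bar>})"
proof -
  interpret D: prob_space D by fact
  note [measurable_cong] = D(2)
  have [simp]: "space D = UNIV" using sets_eq_imp_space_eq[OF D(2)] by simp
  let ?f = "\<lambda>n x. real n powr (r / p - 1) * indicator {x. d * real n powr (1 / p) < \<bar>x\<bar>} x"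
  have eq: "(\<integral>x. ?f n x \<partial>D) = real n powr (r / p - 1) * measure D {x. d * real n powr (1 / p) < \<bar>x\<bar>}" for n
    by simp
  have "summable (\<lambda>n. \<integral>x. ?f n x \<partial>D)"
  proof (rule summable_integral_bound)
    show "integrable D (?f n)" for n
      by (intro integrable_mult_right integrable_real_indicator) (auto simp: less_top[symmetric])
    show "0 \<le> (\<integral>x. ?f n x \<partial>D)" for n by (simp add: eq)
    show "integrable D (\<lambda>x. (1 / d) powr r * \<bar>x\<bar> powr r)" using int by simp
    show "(\<Sum>n<N. ?f n x) \<le> (1 / d) powr r * \<bar>x\<bar> powr r" for N x
    proof -
      have "(\<Sum>n<N. ?f n x) =
          (\<Sum>n<N. real n powr (r / p - 1) * (if real n < (\<bar>x\<bar> / d) powr p then 1 else 0))"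
        by (intro sum.cong) (auto simp: less_powr_inverse_iff[OF d p(1)])
      also have "\<dots> \<le> ((\<bar>x\<bar> / d) powr p) powr (r / p - 1 + 1)"
        using p by (intro sum_powr_less_bound) auto
      also have "\<dots> = (1 / d) powr r * \<bar>x\<bar> powr r"
        using p d by (simp add: powr_powr powr_divide)
      finally show ?thesis .
    qed
  qed
  then show ?thesis by (simp add: eq)
qed

definition trunc :: "real \<Rightarrow> real \<Rightarrow> real" where
  "trunc y x = (if \<bar>x\<bar> \<le> y then x else 0)"

lemma trunc_measurable [measurable]: "trunc y \<in> borel_measurable borel"
  unfolding trunc_def[abs_def] by measurable

lemma abs_trunc_le: "0 \<le> y \<Longrightarrow> \<bar>trunc y x\<bar> \<le> y"
  by (simp add: trunc_def)

text \<open>This is the series left by Chebyshev's inequality: its exponent collects the weight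
  n^(r/p - 2), the n variances and the squared level n^(2/p). For fixed x only the indices n \<ge>
  |x|^p count, and since \<open>r < 2\<close> their tail sum is of order |x|^(r - 2).\<close>

lemma summable_trunc_second_moment:
  fixes D :: "real measure"
  assumes D: "prob_space D" "sets D = sets borel"
    and p: "0 < p" "p \<le> r" and r: "r < 2"
    and int: "integrable D (\<lambda>x. \<bar>x\<bar> powr r)"
  shows "summable (\<lambda>n. real n powr (r / p - 1 - 2 / p) * (\<integral>x. (trunc (real n powr (1 / p)) x)\<^sup>2 \<partial>D))"
proof -
  interpret D: prob_space D by fact
  note [measurable_cong] = D(2)
  define k where "k = (2 - r) / p"
  have k: "0 < k" using p r by (simp add: k_def)
  have e: "r / p - 1 - 2 / p = - k - 1" by (simp add: k_def diff_divide_distrib)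
  let ?f = "\<lambda>n x. real n powr (- k - 1) * (trunc (real n powr (1 / p)) x)\<^sup>2"
  have "summable (\<lambda>n. \<integral>x. ?f n x \<partial>D)"
  proof (rule summable_integral_bound)
    show "integrable D (?f n)" for n
    proof (intro integrable_mult_right D.integrable_const_bound)
      show "AE x in D. norm ((trunc (real n powr (1 / p)) x)\<^sup>2) \<le> (real n powr (1 / p))\<^sup>2"
        by (auto simp: trunc_def abs_le_square_iff[symmetric])
    qed measurable
    show "0 \<le> (\<integral>x. ?f n x \<partial>D)" for n
      by (intro integral_nonneg_AE) auto
    show "integrable D (\<lambda>x. (2 powr (k + 1) / k) * \<bar>x\<bar> powr r)" using int by simp
    show "(\<Sum>n<N. ?f n x) \<le> (2 powr (k + 1) / k) * \<bar>x\<bar> powr r" for N x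
    \<comment> \<open>The point 0 is separate because the tail bound asks for a positive threshold
      |x|^p.\<close>
    proof (cases "x = 0")
      case True
      then show ?thesis by (simp add: trunc_def)
    next
      case False
      have "(\<Sum>n<N. ?f n x) =
          (\<Sum>n<N. x\<^sup>2 * (real n powr (- k - 1) * (if \<bar>x\<bar> powr p \<le> real n then 1 else 0)))"
        using less_powr_inverse_iff[of 1 p _ x] p
        by (intro sum.cong) (auto simp: trunc_def not_less[symmetric])
      also have "\<dots> = x\<^sup>2 * (\<Sum>n<N. real n powr (- k - 1) * (if \<bar>x\<bar> powr p \<le> real n then 1 else 0))"
        by (simp add: sum_distrib_left)
      also have "\<dots> \<le> x\<^sup>2 * ((2 powr (k + 1) / k) * (\<bar>x\<bar> powr p) powr (- k))"
        using False k by (intro mult_left_mono sum_powr_ge_bound) auto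
      also have "\<dots> = (2 powr (k + 1) / k) * (\<bar>x\<bar> powr 2 * \<bar>x\<bar> powr (r - 2))"
        using p False by (simp add: powr_powr k_def powr_numeral)
      also have "\<bar>x\<bar> powr 2 * \<bar>x\<bar> powr (r - 2) = \<bar>x\<bar> powr r"
        using False by (subst powr_add[symmetric]) auto
      finally show ?thesis .
    qed
  qed
  then show ?thesis by (simp add: e)
qed

lemma integrable_abs_powr_le:
  fixes D :: "real measure"
  assumes D: "prob_space D" "sets D = sets borel"
    and p: "0 < p" "p \<le> r"
    and int: "integrable D (\<lambda>x. \<bar>x\<bar> powr r)"
  shows "integrable D (\<lambda>x. \<bar>x\<bar> powr p)"
proof -
  interpret D: prob_space D by fact
  note [measurable_cong] = D(2)
  have le: "t powr p \<le> 1 + t powr r" if "0 \<le> t" for t :: real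
  proof (cases "t \<le> 1")
    case True
    then have "t powr p \<le> 1" using that p powr_mono2[of p t 1] by simp
    then show ?thesis using powr_ge_zero[of t r] by linarith
  next
    case False
    then have "t powr p \<le> t powr r" using p by (intro powr_mono) auto
    then show ?thesis by simp
  qed
  show ?thesis
    by (rule Bochner_Integration.integrable_bound[of _ "\<lambda>x. 1 + \<bar>x\<bar> powr r"]) (auto simp: int le)
qed

text \<open>Dominated convergence with a multiple of |x|^p as majorant. With u = n^(1/p) the
  normalisation is u^(p - 1), and the sign of \<open>p - 1\<close> decides which part of x can be
  estimated: the part cut off if p \<ge> 1, the part kept if p < 1.\<close>

lemma trunc_mean_tendsto:
  fixes D :: "real measure"
  assumes D: "prob_space D" "sets D = sets borel"
    and p: "0 < p" and d: "0 < d"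
    and int: "integrable D (\<lambda>x. \<bar>x\<bar> powr p)"
    and mean: "1 \<le> p \<Longrightarrow> (\<integral>x. x \<partial>D) = 0"
  shows "(\<lambda>n. real n powr (1 - 1 / p) * (\<integral>x. trunc (d * real n powr (1 / p)) x \<partial>D)) \<longlonglongrightarrow> 0"
proof -
  interpret D: prob_space D by fact
  note [measurable_cong] = D(2)
  let ?u = "\<lambda>n. real n powr (1 / p)"
  have u: "real n powr (1 - 1 / p) = ?u n powr (p - 1)" for n
    using p by (simp add: powr_powr diff_divide_distrib)
  have ninf: "filterlim ?u at_top sequentially"
    using p by real_asymp
  show ?thesis
  proof (cases "1 \<le> p")
    case True
    have intx: "integrable D (\<lambda>x. x)"
    proof -
      have "integrable D (\<lambda>x. \<bar>x\<bar> powr 1)"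
        by (rule integrable_abs_powr_le[OF D _ True int]) simp
      then have "integrable D (\<lambda>x. \<bar>x\<bar>)" by simp
      then show ?thesis by (subst (asm) integrable_abs_iff) auto
    qed
    have inttr: "integrable D (trunc (d * ?u n))" for n
      by (rule D.integrable_const_bound[of _ "d * ?u n"]) (auto simp: trunc_def d less_imp_le)
    \<comment> \<open>As the mean vanishes, the truncated mean is minus the mean of the discarded
      part. That part is eventually 0 at each point; where it is nonzero, u \<le> |x| / d yields the
      majorant.\<close>
    let ?s = "\<lambda>n x. ?u n powr (p - 1) * (x - trunc (d * ?u n) x)"
    have "(\<lambda>n. \<integral>x. ?s n x \<partial>D) \<longlonglongrightarrow> (\<integral>x. 0 \<partial>D)"
    proof (rule integral_dominated_convergence)
      show "integrable D (\<lambda>x. (1 / d) powr (p - 1) * \<bar>x\<bar> powr p)" using int by simp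
      show "AE x in D. (\<lambda>n. ?s n x) \<longlonglongrightarrow> 0"
      proof (intro always_eventually allI)
        fix x
        have "eventually (\<lambda>n. \<bar>x\<bar> / d \<le> ?u n) sequentially"
          using ninf by (simp add: filterlim_at_top)
        then have "eventually (\<lambda>n. ?s n x = 0) sequentially"
          by eventually_elim (use d in \<open>auto simp: trunc_def field_simps\<close>)
        then show "(\<lambda>n. ?s n x) \<longlonglongrightarrow> 0" by (rule tendsto_eventually)
      qed
      show "AE x in D. norm (?s n x) \<le> (1 / d) powr (p - 1) * \<bar>x\<bar> powr p" for n
      proof (intro always_eventually allI)
        fix x
        show "norm (?s n x) \<le> (1 / d) powr (p - 1) * \<bar>x\<bar> powr p"
        proof (cases "\<bar>x\<bar> \<le> d * ?u n")
          case False
          then have "?u n \<le> \<bar>x\<bar> / d" using d by (simp add: field_simps)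
          then have "?u n powr (p - 1) \<le> (\<bar>x\<bar> / d) powr (p - 1)"
            using True by (intro powr_mono2) auto
          then have "?u n powr (p - 1) * \<bar>x\<bar> \<le> (\<bar>x\<bar> / d) powr (p - 1) * \<bar>x\<bar>"
            by (rule mult_right_mono) simp
          also have "\<dots> = (1 / d) powr (p - 1) * (\<bar>x\<bar> * \<bar>x\<bar> powr (p - 1))"
            using d by (simp add: powr_divide)
          also have "\<bar>x\<bar> * \<bar>x\<bar> powr (p - 1) = \<bar>x\<bar> powr p"
            by (subst powr_mult_base) auto
          finally show ?thesis using False by (simp add: trunc_def abs_mult)
        qed (simp add: trunc_def)
      qed
    qed measurable
    moreover have "(\<integral>x. ?s n x \<partial>D) = - (?u n powr (p - 1) * (\<integral>x. trunc (d * ?u n) x \<partial>D))" for n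
      using intx inttr mean[OF True] by simp
    ultimately have "(\<lambda>n. - (?u n powr (p - 1) * (\<integral>x. trunc (d * ?u n) x \<partial>D))) \<longlonglongrightarrow> 0"
      by simp
    from tendsto_minus[OF this] show ?thesis unfolding u by simp
  next
    case False
    \<comment> \<open>Here u^(p - 1) itself tends to 0. Where x is kept, |x| / d \<le> u, and the
      negative exponent reverses this into the majorant.\<close>
    let ?s = "\<lambda>n x. ?u n powr (p - 1) * trunc (d * ?u n) x"
    have "(\<lambda>n. \<integral>x. ?s n x \<partial>D) \<longlonglongrightarrow> (\<integral>x. 0 \<partial>D)"
    proof (rule integral_dominated_convergence)
      show "integrable D (\<lambda>x. d powr (1 - p) * \<bar>x\<bar> powr p)" using int by simp
      have lim: "(\<lambda>n. ?u n powr (p - 1)) \<longlonglongrightarrow> 0"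
        using False by (intro tendsto_neg_powr ninf) auto
      show "AE x in D. (\<lambda>n. ?s n x) \<longlonglongrightarrow> 0"
      proof (intro always_eventually allI)
        fix x
        have "(\<lambda>n. ?u n powr (p - 1) * \<bar>x\<bar>) \<longlonglongrightarrow> 0"
          using tendsto_mult_right[OF lim, of "\<bar>x\<bar>"] by simp
        then show "(\<lambda>n. ?s n x) \<longlonglongrightarrow> 0"
          by (rule Lim_null_comparison[rotated]) (auto simp: trunc_def abs_mult)
      qed
      show "AE x in D. norm (?s n x) \<le> d powr (1 - p) * \<bar>x\<bar> powr p" for n
      proof (intro always_eventually allI)
        fix x
        show "norm (?s n x) \<le> d powr (1 - p) * \<bar>x\<bar> powr p"
        proof (cases "\<bar>x\<bar> \<le> d * ?u n \<and> x \<noteq> 0")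
          case True
          then have "\<bar>x\<bar> / d \<le> ?u n" using d by (simp add: field_simps)
          then have "?u n powr (p - 1) \<le> (\<bar>x\<bar> / d) powr (p - 1)"
            using True False d by (intro powr_mono2') auto
          then have "?u n powr (p - 1) * \<bar>x\<bar> \<le> (\<bar>x\<bar> / d) powr (p - 1) * \<bar>x\<bar>"
            by (rule mult_right_mono) simp
          also have "\<dots> = d powr (1 - p) * (\<bar>x\<bar> * \<bar>x\<bar> powr (p - 1))"
            using d powr_minus[of d "p - 1"] by (simp add: powr_divide field_simps)
          also have "\<bar>x\<bar> * \<bar>x\<bar> powr (p - 1) = \<bar>x\<bar> powr p"
            by (subst powr_mult_base) auto
          finally show ?thesis using True by (simp add: trunc_def abs_mult)
        qed (auto simp: trunc_def)
      qed
    qed measurable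
    then show ?thesis unfolding u by simp
  qed
qed

subsection \<open>The Baum--Katz theorem for bounded weights\<close>

lemma exp_le_quadratic:
  fixes z :: real
  shows "exp z \<le> 1 + z + z\<^sup>2 * exp \<bar>z\<bar>"
proof -
  \<comment> \<open>Second-order Taylor expansion with Lagrange remainder; the factor 1/2 is given
    away afterwards.\<close>
  obtain t where t: "\<bar>t\<bar> \<le> \<bar>z\<bar>" "exp z = (\<Sum>m<2. z ^ m / fact m) + exp t / fact 2 * z\<^sup>2"
    using Maclaurin_exp_le[of z 2] by blast
  have "exp t / 2 * z\<^sup>2 \<le> exp \<bar>z\<bar> * z\<^sup>2"
  proof (rule mult_right_mono)
    have "exp t \<le> exp \<bar>z\<bar>" using t(1) by simp
    moreover have "0 < exp t" by simp
    ultimately show "exp t / 2 \<le> exp \<bar>z\<bar>" by linarith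
  qed simp
  then show ?thesis using t(2) by (simp add: eval_nat_numeral mult.commute)
qed

text \<open>When one summand is split off, the cross term vanishes: that summand has mean 0 and is
  independent of the sum of the others. Integrability is carried through the induction so that the
  expectation can be split.\<close>

lemma (in prob_space) expectation_sum_power2_indep:
  fixes Z :: "'i \<Rightarrow> 'a \<Rightarrow> real"
  assumes "finite I" "indep_vars (\<lambda>_. borel) Z I"
    and "\<And>i. i \<in> I \<Longrightarrow> integrable M (Z i)" "\<And>i. i \<in> I \<Longrightarrow> integrable M (\<lambda>\<omega>. (Z i \<omega>)\<^sup>2)"
    and "\<And>i. i \<in> I \<Longrightarrow> expectation (Z i) = 0"
  shows "integrable M (\<lambda>\<omega>. (\<Sum>i\<in>I. Z i \<omega>)\<^sup>2) \<and>
    expectation (\<lambda>\<omega>. (\<Sum>i\<in>I. Z i \<omega>)\<^sup>2) = (\<Sum>i\<in>I. expectation (\<lambda>\<omega>. (Z i \<omega>)\<^sup>2))"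
  using assms
proof (induction I rule: finite_induct)
  case (insert i I)
  let ?W = "\<lambda>\<omega>. \<Sum>i\<in>I. Z i \<omega>"
  have IH: "integrable M (\<lambda>\<omega>. (?W \<omega>)\<^sup>2)"
    "expectation (\<lambda>\<omega>. (?W \<omega>)\<^sup>2) = (\<Sum>i\<in>I. expectation (\<lambda>\<omega>. (Z i \<omega>)\<^sup>2))"
    using insert.IH insert.prems indep_vars_subset[OF insert.prems(1), of I] by blast+
  have W: "integrable M ?W" using insert.prems by auto
  have ind: "indep_var borel (Z i) borel ?W"
    by (intro indep_vars_sum insert.hyps insert.prems)
  have ZW: "integrable M (\<lambda>\<omega>. Z i \<omega> * ?W \<omega>)" "expectation (\<lambda>\<omega>. Z i \<omega> * ?W \<omega>) = 0"
    using indep_var_integrable[OF ind _ W] indep_var_lebesgue_integral[OF ind _ W] insert.prems by auto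
  have eq: "(\<lambda>\<omega>. (\<Sum>i\<in>insert i I. Z i \<omega>)\<^sup>2) = (\<lambda>\<omega>. (Z i \<omega>)\<^sup>2 + (?W \<omega>)\<^sup>2 + 2 * (Z i \<omega> * ?W \<omega>))"
    using insert.hyps by (simp add: power2_sum mult.assoc)
  show ?case
    unfolding eq using insert IH ZW by simp
qed simp

text \<open>\<open>D\<close> is the common law, so expectations in one variable become integrals on
  the real line. The weights form a triangular array because those of the autoregression depend on n
  - k. The bound 1 is a normalisation; a larger bound is absorbed into \<epsilon>.\<close>

locale weighted_iid_sum = prob_space M + D: prob_space D
  for M :: "'a measure" and D :: "real measure" +
  fixes X :: "nat \<Rightarrow> 'a \<Rightarrow> real" and c :: "nat \<Rightarrow> nat \<Rightarrow> real"
  assumes indep: "indep_vars (\<lambda>_. borel) X {1..}"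
    and copies: "\<And>k. 1 \<le> k \<Longrightarrow> distr M borel (X k) = D"
    and weights: "\<And>n k. \<bar>c n k\<bar> \<le> 1"
begin

lemma sets_D [simp, measurable_cong]: "sets D = sets borel"
  unfolding copies[OF order_refl, symmetric] by (rule sets_distr)

lemma space_D [simp]: "space D = UNIV"
  using sets_eq_imp_space_eq[OF sets_D] by simp

lemma prob_D_UNIV [simp]: "D.prob UNIV = 1"
  using D.prob_space by simp

lemma X_measurable: "1 \<le> k \<Longrightarrow> X k \<in> borel_measurable M"
  using indep by (auto simp: indep_vars_def)

lemma expectation_X:
  fixes f :: "real \<Rightarrow> real"
  assumes "1 \<le> k" "f \<in> borel_measurable borel"
  shows "expectation (\<lambda>\<omega>. f (X k \<omega>)) = (\<integral>x. f x \<partial>D)"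
  unfolding copies[OF assms(1), symmetric]
  by (rule integral_distr[symmetric, OF X_measurable[OF assms(1)] assms(2)])

lemma indep_vars_function_X:
  fixes f :: "nat \<Rightarrow> real \<Rightarrow> real"
  assumes "\<And>k. f k \<in> borel_measurable borel"
  shows "indep_vars (\<lambda>_. borel) (\<lambda>k \<omega>. f k (X k \<omega>)) {1..n}"
proof -
  have "indep_vars (\<lambda>_. borel) X {1..n}"
    by (rule indep_vars_subset[OF indep]) auto
  from indep_vars_compose2[OF this, of f "\<lambda>_. borel"] assms show ?thesis by simp
qed

section \<open>Tail bounds through truncation\<close>

lemma prob_le_trunc:
  "prob {\<omega>\<in>space M. x < \<bar>\<Sum>k=1..n. c n k * X k \<omega>\<bar>} \<le>
    real n * measure D {x. y < \<bar>x\<bar>} + prob {\<omega>\<in>space M. x < \<bar>\<Sum>k=1..n. c n k * trunc y (X k \<omega>)\<bar>}"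
proof -
  let ?A = "\<lambda>k. {\<omega>\<in>space M. y < \<bar>X k \<omega>\<bar>}"
  let ?B = "{\<omega>\<in>space M. x < \<bar>\<Sum>k=1..n. c n k * trunc y (X k \<omega>)\<bar>}"
  have A: "?A k \<in> sets M" "prob (?A k) = measure D {x. y < \<bar>x\<bar>}" if "1 \<le> k" for k
  proof -
    have [measurable]: "X k \<in> borel_measurable M" using that X_measurable by simp
    show "?A k \<in> sets M" by measurable
    have "measure D {x. y < \<bar>x\<bar>} = prob (X k -` {x. y < \<bar>x\<bar>} \<inter> space M)"
      unfolding copies[OF that, symmetric] by (rule measure_distr) (auto simp: X_measurable that)
    also have "X k -` {x. y < \<bar>x\<bar>} \<inter> space M = ?A k" by auto
    finally show "prob (?A k) = measure D {x. y < \<bar>x\<bar>}" ..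
  qed
  have [measurable]: "(\<lambda>\<omega>. \<Sum>k=1..n. c n k * trunc y (X k \<omega>)) \<in> borel_measurable M"
    by (intro borel_measurable_sum borel_measurable_times borel_measurable_const
        measurable_compose[OF X_measurable trunc_measurable]) auto
  have B: "?B \<in> sets M" by measurable
  have AU: "(\<Union>k\<in>{1..n}. ?A k) \<in> sets M"
    using A(1) by (intro sets.finite_UN) auto
  \<comment> \<open>Unless one of the first n variables exceeds \<open>y\<close> in absolute value,
    truncation leaves the whole sum unchanged.\<close>
  have sub: "{\<omega>\<in>space M. x < \<bar>\<Sum>k=1..n. c n k * X k \<omega>\<bar>} \<subseteq> (\<Union>k\<in>{1..n}. ?A k) \<union> ?B"
  proof
    fix \<omega> assume \<omega>: "\<omega> \<in> {\<omega>\<in>space M. x < \<bar>\<Sum>k=1..n. c n k * X k \<omega>\<bar>}"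
    show "\<omega> \<in> (\<Union>k\<in>{1..n}. ?A k) \<union> ?B"
    proof (cases "\<exists>k\<in>{1..n}. y < \<bar>X k \<omega>\<bar>")
      case False
      then have "(\<Sum>k=1..n. c n k * trunc y (X k \<omega>)) = (\<Sum>k=1..n. c n k * X k \<omega>)"
        by (intro sum.cong) (auto simp: trunc_def not_less)
      then show ?thesis using \<omega> by auto
    qed (use \<omega> in auto)
  qed
  have "prob {\<omega>\<in>space M. x < \<bar>\<Sum>k=1..n. c n k * X k \<omega>\<bar>} \<le> prob ((\<Union>k\<in>{1..n}. ?A k) \<union> ?B)"
    by (rule finite_measure_mono[OF sub sets.Un[OF AU B]])
  also have "\<dots> \<le> prob (\<Union>k\<in>{1..n}. ?A k) + prob ?B"
    by (rule measure_Un_le[OF AU B])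
  also have "prob (\<Union>k\<in>{1..n}. ?A k) \<le> (\<Sum>k\<in>{1..n}. prob (?A k))"
    using A(1) by (intro measure_UNION_le) auto
  also have "\<dots> = real n * measure D {x. y < \<bar>x\<bar>}"
    using A by simp
  finally show ?thesis by simp
qed

lemma trunc_integrable:
  assumes "0 \<le> y"
  shows "integrable D (trunc y)" "integrable D (\<lambda>x. (trunc y x)\<^sup>2)"
proof -
  show "integrable D (trunc y)"
    by (rule D.integrable_const_bound[of _ y]) (use abs_trunc_le[OF assms] in auto)
  show "integrable D (\<lambda>x. (trunc y x)\<^sup>2)"
    by (rule D.integrable_const_bound[of _ "y\<^sup>2"])
      (use abs_trunc_le[OF assms] assms in \<open>auto simp: abs_le_square_iff[symmetric]\<close>)
qed

text \<open>The assumption on the mean bounds the total effect of centring by \<open>t\<close>, so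
  half of the level \<open>2 * t\<close> pays for centring and half is left for Chebyshev's
  inequality. Weights of modulus at most 1 keep each variance below the truncated second
  moment.\<close>

lemma chebyshev_trunc:
  assumes y: "0 \<le> y" and t: "0 < t"
    and mean: "real n * \<bar>\<integral>x. trunc y x \<partial>D\<bar> \<le> t"
  shows "prob {\<omega>\<in>space M. 2 * t < \<bar>\<Sum>k=1..n. c n k * trunc y (X k \<omega>)\<bar>}
    \<le> real n * (\<integral>x. (trunc y x)\<^sup>2 \<partial>D) / t\<^sup>2"
proof -
  define \<mu> where "\<mu> = (\<integral>x. trunc y x \<partial>D)"
  define f where "f k x = c n k * (trunc y x - \<mu>)" for k x
  let ?Z = "\<lambda>k \<omega>. f k (X k \<omega>)"
  let ?W = "\<lambda>\<omega>. \<Sum>k=1..n. ?Z k \<omega>"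
  have f [measurable]: "f k \<in> borel_measurable borel" for k
    unfolding f_def[abs_def] by measurable
  have bd: "\<bar>f k x\<bar> \<le> y + \<bar>\<mu>\<bar>" for k x
  proof -
    have "\<bar>trunc y x - \<mu>\<bar> \<le> y + \<bar>\<mu>\<bar>" using abs_trunc_le[OF y, of x] by linarith
    then show ?thesis
      using mult_mono[OF weights, of "\<bar>trunc y x - \<mu>\<bar>" "y + \<bar>\<mu>\<bar>" n k] by (simp add: f_def abs_mult)
  qed
  have int: "integrable M (?Z k)" "integrable M (\<lambda>\<omega>. (?Z k \<omega>)\<^sup>2)" if "k \<in> {1..n}" for k
  proof -
    have [measurable]: "X k \<in> borel_measurable M" using that X_measurable by simp
    show "integrable M (?Z k)"
      by (rule integrable_const_bound[of _ "y + \<bar>\<mu>\<bar>"]) (use bd in auto)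
    show "integrable M (\<lambda>\<omega>. (?Z k \<omega>)\<^sup>2)"
      by (rule integrable_const_bound[of _ "(y + \<bar>\<mu>\<bar>)\<^sup>2"])
        (use bd y in \<open>auto simp: abs_le_square_iff[symmetric]\<close>)
  qed
  have mean0: "expectation (?Z k) = 0" if "k \<in> {1..n}" for k
  proof -
    have "expectation (?Z k) = (\<integral>x. f k x \<partial>D)"
      using that by (intro expectation_X[of k "f k"] f) auto
    also have "\<dots> = 0"
      using trunc_integrable[OF y] by (simp add: f_def \<mu>_def)
    finally show ?thesis .
  qed
  have var: "expectation (\<lambda>\<omega>. (?Z k \<omega>)\<^sup>2) \<le> (\<integral>x. (trunc y x)\<^sup>2 \<partial>D)" if "k \<in> {1..n}" for k
  proof -
    have "expectation (\<lambda>\<omega>. (?Z k \<omega>)\<^sup>2) = (\<integral>x. (f k x)\<^sup>2 \<partial>D)"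
      using that by (intro expectation_X[of k "\<lambda>x. (f k x)\<^sup>2"]) auto
    also have "\<dots> = (c n k)\<^sup>2 * (\<integral>x. (trunc y x - \<mu>)\<^sup>2 \<partial>D)"
      by (simp add: f_def power_mult_distrib)
    also have "(\<integral>x. (trunc y x - \<mu>)\<^sup>2 \<partial>D) = (\<integral>x. (trunc y x)\<^sup>2 \<partial>D) - \<mu>\<^sup>2"
      unfolding \<mu>_def using trunc_integrable[OF y] by (intro D.variance_eq) auto
    also have "(c n k)\<^sup>2 * ((\<integral>x. (trunc y x)\<^sup>2 \<partial>D) - \<mu>\<^sup>2) \<le> 1 * (\<integral>x. (trunc y x)\<^sup>2 \<partial>D)"
    proof (rule mult_mono')
      show "(c n k)\<^sup>2 \<le> 1" using weights[of n k] by (simp add: abs_square_le_1)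
      have "0 \<le> (\<integral>x. (trunc y x - \<mu>)\<^sup>2 \<partial>D)" by (intro integral_nonneg_AE) auto
      also have "\<dots> = (\<integral>x. (trunc y x)\<^sup>2 \<partial>D) - \<mu>\<^sup>2"
        unfolding \<mu>_def using trunc_integrable[OF y] by (intro D.variance_eq) auto
      finally show "0 \<le> (\<integral>x. (trunc y x)\<^sup>2 \<partial>D) - \<mu>\<^sup>2" .
    qed auto
    finally show ?thesis by simp
  qed
  have W: "integrable M (\<lambda>\<omega>. (?W \<omega>)\<^sup>2)"
    "expectation (\<lambda>\<omega>. (?W \<omega>)\<^sup>2) = (\<Sum>k=1..n. expectation (\<lambda>\<omega>. (?Z k \<omega>)\<^sup>2))"
    using expectation_sum_power2_indep[OF finite_atLeastAtMost indep_vars_function_X[of f, OF f] int mean0]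
    by blast+
  have sub: "{\<omega>\<in>space M. 2 * t < \<bar>\<Sum>k=1..n. c n k * trunc y (X k \<omega>)\<bar>} \<subseteq> {\<omega>\<in>space M. t\<^sup>2 \<le> (?W \<omega>)\<^sup>2}"
  proof safe
    fix \<omega> assume *: "2 * t < \<bar>\<Sum>k=1..n. c n k * trunc y (X k \<omega>)\<bar>"
    have "\<bar>\<Sum>k=1..n. c n k * \<mu>\<bar> \<le> (\<Sum>k=1..n. \<bar>c n k * \<mu>\<bar>)" by (rule sum_abs)
    also have "\<dots> \<le> (\<Sum>k=1..n. \<bar>\<mu>\<bar>)"
      using weights by (intro sum_mono) (simp add: abs_mult mult_left_le_one_le)
    also have "\<dots> \<le> t" using mean by (simp add: \<mu>_def)
    finally have "\<bar>\<Sum>k=1..n. c n k * \<mu>\<bar> \<le> t" .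
    moreover have "(\<Sum>k=1..n. c n k * trunc y (X k \<omega>)) = ?W \<omega> + (\<Sum>k=1..n. c n k * \<mu>)"
      by (simp add: f_def right_diff_distrib sum_subtractf)
    ultimately have "t \<le> \<bar>?W \<omega>\<bar>" using * by linarith
    then show "t\<^sup>2 \<le> (?W \<omega>)\<^sup>2" using t by (simp add: abs_le_square_iff[symmetric])
  qed
  have "prob {\<omega>\<in>space M. 2 * t < \<bar>\<Sum>k=1..n. c n k * trunc y (X k \<omega>)\<bar>} \<le> prob {\<omega>\<in>space M. t\<^sup>2 \<le> (?W \<omega>)\<^sup>2}"
    using W(1) by (intro finite_measure_mono sub borel_measurable_le borel_measurable_const)
      (rule borel_measurable_integrable)
  also have "\<dots> \<le> expectation (\<lambda>\<omega>. (?W \<omega>)\<^sup>2) / t\<^sup>2"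
    using t by (intro integral_Markov_inequality_measure[OF W(1), of "{}"]) auto
  also have "\<dots> \<le> real n * (\<integral>x. (trunc y x)\<^sup>2 \<partial>D) / t\<^sup>2"
    unfolding W(2) using sum_mono[OF var, of "{1..n}" "\<lambda>k. k"] by (intro divide_right_mono) auto
  finally show ?thesis .
qed

text \<open>Exponential Markov inequality with tilt \<open>l\<close>, where the sign
  \<open>e\<close> selects the upper or the lower tail. The variables are not centred: their mean
  stays in the exponent as a linear term, while truncation bounds the second-order remainder through
  the factor \<open>exp (l * y)\<close>.\<close>

lemma exponential_trunc:
  assumes y: "0 \<le> y" and l: "0 \<le> l" and m: "integrable D (\<lambda>x. x\<^sup>2)" and e: "\<bar>e\<bar> = 1"
  shows "prob {\<omega>\<in>space M. t \<le> e * (\<Sum>k=1..n. c n k * trunc y (X k \<omega>))}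
    \<le> exp (real n * (l * \<bar>\<integral>x. trunc y x \<partial>D\<bar> + l\<^sup>2 * (\<integral>x. x\<^sup>2 \<partial>D) * exp (l * y)) - l * t)"
proof -
  define \<mu> where "\<mu> = (\<integral>x. trunc y x \<partial>D)"
  define v where "v = (\<integral>x. x\<^sup>2 \<partial>D)"
  define d where "d k = e * c n k" for k
  have d: "\<bar>d k\<bar> \<le> 1" for k using weights e by (simp add: d_def abs_mult)
  define f where "f k x = exp (l * (d k * trunc y x))" for k x
  let ?V = "\<lambda>\<omega>. \<Prod>k=1..n. f k (X k \<omega>)"
  have f [measurable]: "f k \<in> borel_measurable borel" for k
    unfolding f_def[abs_def] by measurable
  have dt: "\<bar>l * (d k * trunc y x)\<bar> \<le> l * y" for k x
  proof -
    have "\<bar>d k * trunc y x\<bar> \<le> 1 * y"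
      unfolding abs_mult using d abs_trunc_le[OF y] by (intro mult_mono) auto
    then show ?thesis using l by (simp add: abs_mult mult_left_mono)
  qed
  have bd: "\<bar>f k x\<bar> \<le> exp (l * y)" for k x
    using dt[of k x] by (simp add: f_def)
  have int: "integrable M (\<lambda>\<omega>. f k (X k \<omega>))" if "k \<in> {1..n}" for k
  proof -
    have [measurable]: "X k \<in> borel_measurable M" using that X_measurable by simp
    show ?thesis
      by (rule integrable_const_bound[of _ "exp (l * y)"]) (use bd in auto)
  qed
  have V: "integrable M ?V" "expectation ?V = (\<Prod>k=1..n. expectation (\<lambda>\<omega>. f k (X k \<omega>)))"
    using indep_vars_integrable[OF finite_atLeastAtMost indep_vars_function_X[of f, OF f] int]
      indep_vars_lebesgue_integral[OF finite_atLeastAtMost indep_vars_function_X[of f, OF f] int]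
    by blast+
  \<comment> \<open>\<open>exp_le_quadratic\<close> bounds the expectation of each factor by 1 + q,
    and 1 + q \<le> exp q makes the bound multiply well over the n independent factors.\<close>
  define q where "q = l * \<bar>\<mu>\<bar> + l\<^sup>2 * v * exp (l * y)"
  have one: "0 \<le> expectation (\<lambda>\<omega>. f k (X k \<omega>)) \<and> expectation (\<lambda>\<omega>. f k (X k \<omega>)) \<le> exp q"
    if k: "k \<in> {1..n}" for k
  proof
    show "0 \<le> expectation (\<lambda>\<omega>. f k (X k \<omega>))"
      by (intro integral_nonneg_AE) (auto simp: f_def)
    have intf: "integrable D (f k)"
      by (rule D.integrable_const_bound[of _ "exp (l * y)"]) (use bd in auto)
    have le: "f k x \<le> 1 + (l * d k) * trunc y x + (l\<^sup>2 * exp (l * y)) * x\<^sup>2" for x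
    proof -
      let ?z = "l * (d k * trunc y x)"
      have "?z\<^sup>2 = l\<^sup>2 * ((d k)\<^sup>2 * (trunc y x)\<^sup>2)" by (simp add: power_mult_distrib)
      also have "\<dots> \<le> l\<^sup>2 * (1 * x\<^sup>2)"
        using d[of k] by (intro mult_left_mono mult_mono) (auto simp: abs_square_le_1 trunc_def)
      finally have "?z\<^sup>2 * exp \<bar>?z\<bar> \<le> l\<^sup>2 * x\<^sup>2 * exp (l * y)"
        using dt[of k x] by (intro mult_mono) auto
      then show ?thesis using exp_le_quadratic[of ?z] by (simp add: f_def mult_ac)
    qed
    have "expectation (\<lambda>\<omega>. f k (X k \<omega>)) = (\<integral>x. f k x \<partial>D)"
      using k by (intro expectation_X[of k "f k"] f) auto
    also have "\<dots> \<le> (\<integral>x. 1 + (l * d k) * trunc y x + (l\<^sup>2 * exp (l * y)) * x\<^sup>2 \<partial>D)"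
      using le trunc_integrable[OF y] m intf by (intro integral_mono) auto
    also have "\<dots> = 1 + l * d k * \<mu> + l\<^sup>2 * exp (l * y) * v"
      using trunc_integrable[OF y] m by (simp add: \<mu>_def v_def)
    also have "l * d k * \<mu> \<le> l * \<bar>\<mu>\<bar>"
    proof -
      have "d k * \<mu> \<le> \<bar>d k\<bar> * \<bar>\<mu>\<bar>" by (metis abs_ge_self abs_mult)
      also have "\<dots> \<le> \<bar>\<mu>\<bar>" using d[of k] by (simp add: mult_left_le_one_le)
      finally show ?thesis using l by (simp add: mult.assoc mult_left_mono)
    qed
    finally have "expectation (\<lambda>\<omega>. f k (X k \<omega>)) \<le> 1 + q" by (simp add: q_def mult_ac)
    then show "expectation (\<lambda>\<omega>. f k (X k \<omega>)) \<le> exp q"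
      using exp_ge_add_one_self[of q] by linarith
  qed
  have EV: "expectation ?V \<le> exp (real n * q)"
  proof -
    have "expectation ?V \<le> (\<Prod>k=1..n. exp q)"
      unfolding V(2) using one by (intro prod_mono) auto
    then show ?thesis by (simp add: exp_of_nat_mult)
  qed
  have Veq: "?V \<omega> = exp (l * (e * (\<Sum>k=1..n. c n k * trunc y (X k \<omega>))))" for \<omega>
    by (simp add: f_def d_def exp_sum[symmetric] sum_distrib_left mult.assoc)
  have sub: "{\<omega>\<in>space M. t \<le> e * (\<Sum>k=1..n. c n k * trunc y (X k \<omega>))} \<subseteq> {\<omega>\<in>space M. exp (l * t) \<le> ?V \<omega>}"
    unfolding Veq using l by (auto intro: mult_left_mono)
  have "prob {\<omega>\<in>space M. t \<le> e * (\<Sum>k=1..n. c n k * trunc y (X k \<omega>))} \<le> prob {\<omega>\<in>space M. exp (l * t) \<le> ?V \<omega>}"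
    using V(1) by (intro finite_measure_mono sub borel_measurable_le borel_measurable_const)
      (rule borel_measurable_integrable)
  also have "\<dots> \<le> expectation ?V / exp (l * t)"
    by (intro integral_Markov_inequality_measure[OF V(1), of "{}"]) (auto simp: f_def prod_nonneg)
  also have "\<dots> \<le> exp (real n * q) / exp (l * t)"
    using EV by (intro divide_right_mono) auto
  finally show ?thesis by (simp add: q_def \<mu>_def v_def exp_diff)
qed

section \<open>Convergence of the series in the two moment regimes\<close>

lemma eventually_trunc_mean_le:
  assumes p: "0 < p" "p \<le> r" and d: "0 < d" and t: "0 < t"
    and int: "integrable D (\<lambda>x. \<bar>x\<bar> powr r)"
    and mean: "1 \<le> r \<Longrightarrow> (\<integral>x. x \<partial>D) = 0"
  shows "eventually (\<lambda>n. real n * \<bar>\<integral>x. trunc (d * real n powr (1 / p)) x \<partial>D\<bar> \<le> t * real n powr (1 / p))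
    sequentially"
proof -
  let ?I = "\<lambda>n. \<integral>x. trunc (d * real n powr (1 / p)) x \<partial>D"
  \<comment> \<open>The moment of order r yields one of order p, and p \<ge> 1 forces r \<ge> 1, so
    the mean vanishes whenever the limit lemma asks for it.\<close>
  have "(\<lambda>n. real n powr (1 - 1 / p) * ?I n) \<longlonglongrightarrow> 0"
    using p d mean integrable_abs_powr_le[OF D.prob_space_axioms sets_D p int]
    by (intro trunc_mean_tendsto D.prob_space_axioms) auto
  from tendstoD[OF this t]
  have "eventually (\<lambda>n. real n powr (1 - 1 / p) * \<bar>?I n\<bar> < t) sequentially"
    by (simp add: dist_real_def abs_mult)
  with eventually_gt_at_top[of 0] show ?thesis
  proof eventually_elim
    case (elim n)
    have "real n * \<bar>?I n\<bar> = (real n powr (1 - 1 / p) * \<bar>?I n\<bar>) * real n powr (1 / p)"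
      using elim(1) by (simp add: powr_diff)
    also have "\<dots> \<le> t * real n powr (1 / p)"
      using elim(2) by (intro mult_right_mono) auto
    finally show ?case .
  qed
qed

text \<open>Removing the truncation costs a union bound whose series converges by the moment of
  order r. The level \<open>d\<close> stays free because the two regimes choose it
  differently.\<close>

lemma summable_prob_of_summable_trunc:
  assumes p: "0 < p" "p \<le> r" and d: "0 < d"
    and int: "integrable D (\<lambda>x. \<bar>x\<bar> powr r)"
    and g: "summable g"
    and le: "eventually (\<lambda>n. real n powr (r / p - 2) *
        prob {\<omega>\<in>space M. \<epsilon> * real n powr (1 / p) < \<bar>\<Sum>k=1..n. c n k * trunc (d * real n powr (1 / p)) (X k \<omega>)\<bar>}
        \<le> g n) sequentially"
  shows "summable (\<lambda>n. real n powr (r / p - 2) *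
    prob {\<omega>\<in>space M. \<epsilon> * real n powr (1 / p) < \<bar>\<Sum>k=1..n. c n k * X k \<omega>\<bar>})"
proof (rule summable_comparison_test_ev)
  let ?h = "\<lambda>n. real n powr (r / p - 1) * measure D {x. d * real n powr (1 / p) < \<bar>x\<bar>}"
  show "summable (\<lambda>n. ?h n + g n)"
    using summable_tail_prob[OF D.prob_space_axioms sets_D p d int] g by (rule summable_add)
  show "eventually (\<lambda>n. norm (real n powr (r / p - 2) *
      prob {\<omega>\<in>space M. \<epsilon> * real n powr (1 / p) < \<bar>\<Sum>k=1..n. c n k * X k \<omega>\<bar>}) \<le> ?h n + g n) sequentially"
    using le eventually_gt_at_top[of 0]
  proof eventually_elim
    case (elim n)
    let ?u = "real n powr (1 / p)"
    let ?T = "prob {\<omega>\<in>space M. \<epsilon> * ?u < \<bar>\<Sum>k=1..n. c n k * trunc (d * ?u) (X k \<omega>)\<bar>}"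
    have "real n powr (r / p - 2) * prob {\<omega>\<in>space M. \<epsilon> * ?u < \<bar>\<Sum>k=1..n. c n k * X k \<omega>\<bar>}
        \<le> real n powr (r / p - 2) * (real n * measure D {x. d * ?u < \<bar>x\<bar>} + ?T)"
      by (intro mult_left_mono prob_le_trunc) auto
    also have "\<dots> = (real n * real n powr (r / p - 2)) * measure D {x. d * ?u < \<bar>x\<bar>} + real n powr (r / p - 2) * ?T"
      by (simp add: algebra_simps)
    also have "real n * real n powr (r / p - 2) = real n powr (r / p - 1)"
      by (subst powr_mult_base) auto
    finally show ?case using elim(1) by simp
  qed
qed

text \<open>Truncation at n^(1/p) and Chebyshev's inequality, with half of \<epsilon> spent on
  centring; hence the constant 4 / \<epsilon>^2.\<close>

lemma baum_katz_small_moment: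
  assumes p: "0 < p" "p \<le> r" and r: "r < 2" and \<epsilon>: "0 < \<epsilon>"
    and int: "integrable D (\<lambda>x. \<bar>x\<bar> powr r)"
    and mean: "1 \<le> r \<Longrightarrow> (\<integral>x. x \<partial>D) = 0"
  shows "summable (\<lambda>n. real n powr (r / p - 2) *
    prob {\<omega>\<in>space M. \<epsilon> * real n powr (1 / p) < \<bar>\<Sum>k=1..n. c n k * X k \<omega>\<bar>})"
proof (rule summable_prob_of_summable_trunc[OF p zero_less_one int])
  let ?E = "\<lambda>n. \<integral>x. (trunc (real n powr (1 / p)) x)\<^sup>2 \<partial>D"
  show "summable (\<lambda>n. (4 / \<epsilon>\<^sup>2) * (real n powr (r / p - 1 - 2 / p) * ?E n))"
    by (intro summable_mult summable_trunc_second_moment D.prob_space_axioms sets_D p r int)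
  show "eventually (\<lambda>n. real n powr (r / p - 2) *
      prob {\<omega>\<in>space M. \<epsilon> * real n powr (1 / p) < \<bar>\<Sum>k=1..n. c n k * trunc (1 * real n powr (1 / p)) (X k \<omega>)\<bar>}
      \<le> (4 / \<epsilon>\<^sup>2) * (real n powr (r / p - 1 - 2 / p) * ?E n)) sequentially"
    using eventually_trunc_mean_le[OF p zero_less_one half_gt_zero[OF \<epsilon>] int, OF mean, simplified]
      eventually_gt_at_top[of 0]
  proof eventually_elim
    case (elim n)
    let ?u = "real n powr (1 / p)"
    have u: "0 < ?u" using elim by simp
    have "prob {\<omega>\<in>space M. 2 * (\<epsilon> / 2 * ?u) < \<bar>\<Sum>k=1..n. c n k * trunc (1 * ?u) (X k \<omega>)\<bar>}
        \<le> real n * (\<integral>x. (trunc (1 * ?u) x)\<^sup>2 \<partial>D) / (\<epsilon> / 2 * ?u)\<^sup>2"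
      using u \<epsilon> elim by (intro chebyshev_trunc) auto
    then have "real n powr (r / p - 2) * prob {\<omega>\<in>space M. \<epsilon> * ?u < \<bar>\<Sum>k=1..n. c n k * trunc (1 * ?u) (X k \<omega>)\<bar>}
        \<le> real n powr (r / p - 2) * (real n * ?E n / (\<epsilon> / 2 * ?u)\<^sup>2)"
      by (intro mult_left_mono) auto
    also have "\<dots> = (4 / \<epsilon>\<^sup>2) * (((real n * real n powr (r / p - 2)) / ?u\<^sup>2) * ?E n)"
      by (simp add: power_mult_distrib power_divide)
    also have "real n * real n powr (r / p - 2) = real n powr (r / p - 1)"
      by (subst powr_mult_base) auto
    also have "?u\<^sup>2 = real n powr (2 / p)"
      using u elim by (simp add: powr_power)
    also have "real n powr (r / p - 1) / real n powr (2 / p) = real n powr (r / p - 1 - 2 / p)"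
      by (simp add: powr_diff)
    finally show ?case .
  qed
qed

text \<open>With a finite second moment Chebyshev's inequality would leave n^((r - 2)/p - 1), whose
  exponent is at least -1. The exponential bound gives a probability of order n^(-r/p), and the
  weighted terms become of order n^(-2).\<close>

lemma baum_katz_large_moment:
  assumes p: "0 < p" "p < 2" and r: "2 \<le> r" and \<epsilon>: "0 < \<epsilon>"
    and int: "integrable D (\<lambda>x. \<bar>x\<bar> powr r)"
    and mean: "(\<integral>x. x \<partial>D) = 0"
  shows "summable (\<lambda>n. real n powr (r / p - 2) *
    prob {\<omega>\<in>space M. \<epsilon> * real n powr (1 / p) < \<bar>\<Sum>k=1..n. c n k * X k \<omega>\<bar>})"
proof -
  have pr: "p \<le> r" using p r by simp
  define v where "v = (\<integral>x. x\<^sup>2 \<partial>D)"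
  have v: "integrable D (\<lambda>x. x\<^sup>2)"
    using integrable_abs_powr_le[OF D.prob_space_axioms sets_D _ r int] by simp
  \<comment> \<open>Truncating at \<open>\<delta> n^(1/p)\<close> and tilting with \<open>\<lambda> = \<eta> ln n / (\<delta> n^(1/p))\<close> costs only a factor
    \<open>n^\<eta>\<close> in the second-order term, while the main term becomes \<open>\<epsilon> \<eta> ln n / \<delta> = 2 (r/p) ln n\<close>.\<close>
  define \<eta> where "\<eta> = (2 / p - 1) / 2"
  define \<delta> where "\<delta> = \<eta> * \<epsilon> * p / (2 * r)"
  have \<eta>: "0 < \<eta>" using p by (simp add: \<eta>_def field_simps)
  have \<delta>: "0 < \<delta>" using \<eta> \<epsilon> p r by (simp add: \<delta>_def)
  have \<delta>_eq: "\<eta> * \<epsilon> / \<delta> = 2 * (r / p)"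
    using \<eta> \<epsilon> p r by (simp add: \<delta>_def field_simps)
  \<comment> \<open>This quantity is the second-order term n * l^2 * v * n^\<eta> of the exponent:
    since 2/p - 1 = 2 * \<eta>, the total power 1 + \<eta> - 2/p equals -\<eta>.\<close>
  have "(\<lambda>n. (ln (real n))\<^sup>2 * real n powr (- \<eta>)) \<longlonglongrightarrow> 0"
    using \<eta> by real_asymp
  then have "(\<lambda>n. ((\<eta> / \<delta>)\<^sup>2 * v) * ((ln (real n))\<^sup>2 * real n powr (- \<eta>))) \<longlonglongrightarrow> ((\<eta> / \<delta>)\<^sup>2 * v) * 0"
    by (rule tendsto_mult_left)
  then have small: "eventually (\<lambda>n. ((\<eta> / \<delta>)\<^sup>2 * v) * ((ln (real n))\<^sup>2 * real n powr (- \<eta>)) < 1) sequentially"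
    by (intro order_tendstoD(2)) auto
  show ?thesis
  proof (rule summable_prob_of_summable_trunc[OF p(1) pr \<delta> int])
    show "summable (\<lambda>n. 2 * exp 1 * real n powr (- 2))"
      by (intro summable_mult) (simp add: summable_real_powr_iff)
    show "eventually (\<lambda>n. real n powr (r / p - 2) *
      prob {\<omega>\<in>space M. \<epsilon> * real n powr (1 / p) < \<bar>\<Sum>k=1..n. c n k * trunc (\<delta> * real n powr (1 / p)) (X k \<omega>)\<bar>}
      \<le> 2 * exp 1 * real n powr (- 2)) sequentially"
      using eventually_trunc_mean_le[OF p(1) pr \<delta> half_gt_zero[OF \<epsilon>] int mean] small eventually_gt_at_top[of 0]
    proof eventually_elim
      case (elim n)
      let ?u = "real n powr (1 / p)"
      let ?W = "\<lambda>\<omega>. \<Sum>k=1..n. c n k * trunc (\<delta> * ?u) (X k \<omega>)"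
      define \<mu> where "\<mu> = (\<integral>x. trunc (\<delta> * ?u) x \<partial>D)"
      have n: "0 < real n" and u: "0 < ?u" using elim(3) by auto
      define l where "l = \<eta> * ln (real n) / (\<delta> * ?u)"
      have l: "0 \<le> l" using \<eta> \<delta> u elim(3) by (simp add: l_def)
      have e1: "exp (l * (\<delta> * ?u)) = real n powr \<eta>"
        using \<delta> u n by (simp add: l_def powr_def)
      \<comment> \<open>\<open>L\<close> is half of the main term. The means use up at most
        \<open>L\<close> and the second-order term at most 1, so the exponent is at most 1 -
        L.\<close>
      define L where "L = r / p * ln (real n)"
      have e2: "l * (\<epsilon> * ?u) = 2 * L"
      proof -
        have "l * (\<epsilon> * ?u) = (\<eta> * \<epsilon> / \<delta>) * ln (real n)"
          using u by (simp add: l_def)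
        then show ?thesis by (simp add: \<delta>_eq L_def)
      qed
      have e3: "real n * (l\<^sup>2 * v * exp (l * (\<delta> * ?u))) \<le> 1"
      proof -
        have "real n * (l\<^sup>2 * v * exp (l * (\<delta> * ?u))) =
            ((\<eta> / \<delta>)\<^sup>2 * v) * ((ln (real n))\<^sup>2 * (real n * real n powr \<eta> / ?u\<^sup>2))"
          unfolding e1 by (simp add: l_def power_mult_distrib power_divide)
        also have "real n * real n powr \<eta> / ?u\<^sup>2 = real n powr (1 + \<eta> - 2 / p)"
          using n by (simp add: powr_power powr_add powr_diff)
        also have "1 + \<eta> - 2 / p = - \<eta>" by (simp add: \<eta>_def field_simps)
        finally show ?thesis using elim(2) by linarith
      qed
      have e4: "real n * (l * \<bar>\<mu>\<bar>) \<le> L"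
      proof -
        have "real n * (l * \<bar>\<mu>\<bar>) = l * (real n * \<bar>\<mu>\<bar>)" by simp
        also have "\<dots> \<le> l * (\<epsilon> / 2 * ?u)"
          using elim(1) l by (intro mult_left_mono) (auto simp: \<mu>_def)
        also have "\<dots> = L" using e2 by simp
        finally show ?thesis .
      qed
      have half: "prob {\<omega>\<in>space M. \<epsilon> * ?u \<le> e * ?W \<omega>} \<le> exp 1 * real n powr (- (r / p))"
        if e: "\<bar>e\<bar> = 1" for e
      proof -
        have "prob {\<omega>\<in>space M. \<epsilon> * ?u \<le> e * ?W \<omega>} \<le>
            exp (real n * (l * \<bar>\<mu>\<bar> + l\<^sup>2 * v * exp (l * (\<delta> * ?u))) - l * (\<epsilon> * ?u))"
          unfolding \<mu>_def v_def using \<delta> u by (intro exponential_trunc l v e) auto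
        also have "\<dots> \<le> exp (1 - L)"
          unfolding exp_le_cancel_iff e2 distrib_left using e3 e4 by linarith
        also have "\<dots> = exp 1 * exp (- L)"
          by (simp flip: exp_add)
        also have "exp (- L) = real n powr (- (r / p))"
          using n by (simp add: L_def powr_def)
        finally show ?thesis .
      qed
      define W where "W = ?W"
      have [measurable]: "W \<in> borel_measurable M"
        unfolding W_def by (intro borel_measurable_sum borel_measurable_times borel_measurable_const
            measurable_compose[OF X_measurable trunc_measurable]) auto
      \<comment> \<open>The two tails, bounded with e = 1 and e = -1, account for the factor
        2.\<close>
      have "prob {\<omega>\<in>space M. \<epsilon> * ?u < \<bar>W \<omega>\<bar>} \<le>
          prob ({\<omega>\<in>space M. \<epsilon> * ?u \<le> 1 * W \<omega>} \<union> {\<omega>\<in>space M. \<epsilon> * ?u \<le> -1 * W \<omega>})"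
        by (rule finite_measure_mono) (auto, measurable)
      also have "\<dots> \<le> prob {\<omega>\<in>space M. \<epsilon> * ?u \<le> 1 * W \<omega>} + prob {\<omega>\<in>space M. \<epsilon> * ?u \<le> -1 * W \<omega>}"
        by (intro measure_Un_le) measurable
      also have "\<dots> \<le> 2 * exp 1 * real n powr (- (r / p))"
        using half[of 1] half[of "-1"] by (simp add: W_def)
      finally have "real n powr (r / p - 2) * prob {\<omega>\<in>space M. \<epsilon> * ?u < \<bar>W \<omega>\<bar>}
          \<le> real n powr (r / p - 2) * (2 * exp 1 * real n powr (- (r / p)))"
        by (rule mult_left_mono) simp
      also have "\<dots> = 2 * exp 1 * (real n powr (r / p - 2) * real n powr (- (r / p)))"
        by simp
      also have "real n powr (r / p - 2) * real n powr (- (r / p)) = real n powr (- 2)"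
        by (subst powr_add[symmetric]) simp
      finally show ?case unfolding W_def .
    qed
  qed
qed

end

subsection \<open>The step response of the autoregression\<close>

text \<open>The hypotheses place the roots of z^2 = a z + b in the open unit disc. Instead of
  solving for the roots, which would separate real, complex and double ones, the proof uses a
  quadratic form in two consecutive values that never increases.\<close>

lemma linear_recurrence_bounded:
  fixes a b :: real and d :: "nat \<Rightarrow> real"
  assumes b: "- 1 < b" "b < 1 - \<bar>a\<bar>"
    and rec: "\<And>n. d (Suc (Suc n)) = a * d (Suc n) + b * d n"
  obtains C where "\<And>n. \<bar>d n\<bar> \<le> C"
proof -
  define \<Delta> where "\<Delta> = (1 - b)\<^sup>2 - a\<^sup>2"
  have "\<bar>a\<bar>\<^sup>2 < (1 - b)\<^sup>2" using b by (intro power_strict_mono) auto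
  then have \<Delta>: "0 < \<Delta>" by (simp add: \<Delta>_def)
  have b1: "0 < 1 - b" using b by linarith
  \<comment> \<open>A quadratic Lyapunov function of the companion matrix.\<close>
  define V where "V n = (1 - b) * (d (Suc n))\<^sup>2 + 2 * a * b * d (Suc n) * d n + (1 - b) * b\<^sup>2 * (d n)\<^sup>2" for n
  have "V n - V (Suc n) = (1 + b) * \<Delta> * (d (Suc n))\<^sup>2" for n
    unfolding V_def rec \<Delta>_def by algebra
  moreover have "0 \<le> (1 + b) * \<Delta> * (d (Suc n))\<^sup>2" for n using b \<Delta> by simp
  ultimately have "V (Suc n) \<le> V n" for n by (metis diff_ge_0_iff_ge)
  then have "decseq V" by (rule decseq_SucI)
  then have V0: "V n \<le> V 0" for n by (rule decseqD) simp
  \<comment> \<open>Completing the square shows that the quadratic form controls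
    \<open>d (Suc n)\<close>.\<close>
  have *: "\<Delta> * (d (Suc n))\<^sup>2 \<le> (1 - b) * V 0" for n
  proof -
    have "(1 - b) * V n = \<Delta> * (d (Suc n))\<^sup>2 + (a * d (Suc n) + (1 - b) * b * d n)\<^sup>2"
      unfolding V_def \<Delta>_def by algebra
    moreover have "(1 - b) * V n \<le> (1 - b) * V 0" using V0 b1 by (intro mult_left_mono) auto
    ultimately show ?thesis by (smt (verit) zero_le_power2)
  qed
  define K where "K = (1 - b) * V 0 / \<Delta>"
  have K: "\<bar>d (Suc n)\<bar> \<le> 1 + K" for n
  proof -
    have "(d (Suc n))\<^sup>2 \<le> K"
      using *[of n] \<Delta> by (simp add: K_def field_simps)
    moreover have "\<bar>d (Suc n)\<bar> \<le> 1 + (d (Suc n))\<^sup>2"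
    proof -
      have "0 \<le> (\<bar>d (Suc n)\<bar> - 1)\<^sup>2 + \<bar>d (Suc n)\<bar>\<^sup>2 + 1" by simp
      then show ?thesis by (simp add: power2_diff)
    qed
    ultimately show ?thesis by linarith
  qed
  \<comment> \<open>The estimate covers successor indices only, so the value at 0 is added by
    hand.\<close>
  have "\<bar>d n\<bar> \<le> max \<bar>d 0\<bar> (1 + K)" for n
    by (cases n) (auto simp: le_max_iff_disj K)
  then show ?thesis by (rule that)
qed

text \<open>The response from rest to the constant input 1, that is, the cumulative impulse
  response; the value at lag n - k is the weight of \<theta>_k in S_n.\<close>

fun step_response :: "real \<Rightarrow> real \<Rightarrow> nat \<Rightarrow> real" where
  "step_response a b 0 = 1"
| "step_response a b (Suc 0) = 1 + a"
| "step_response a b (Suc (Suc n)) = a * step_response a b (Suc n) + b * step_response a b n + 1"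

text \<open>Subtracting the equilibrium 1 / (1 - a - b) makes the recurrence homogeneous. The bound
  is taken to be at least 1 so that the weights can be divided by it.\<close>

lemma step_response_bounded:
  assumes b: "- 1 < b" "b < 1 - \<bar>a\<bar>"
  obtains C where "1 \<le> C" "\<And>n. \<bar>step_response a b n\<bar> \<le> C"
proof -
  define q where "q = 1 / (1 - a - b)"
  have "q * (1 - a - b) = 1" using b by (simp add: q_def)
  then have q: "a * q + b * q + 1 = q" by (simp add: algebra_simps)
  obtain C where C: "\<And>n. \<bar>step_response a b n - q\<bar> \<le> C"
  proof (rule linear_recurrence_bounded[OF b])
    show "step_response a b (Suc (Suc n)) - q =
        a * (step_response a b (Suc n) - q) + b * (step_response a b n - q)" for n
      using q by (simp add: algebra_simps)
  qed blast
  have "\<bar>step_response a b n\<bar> \<le> 1 + \<bar>q\<bar> + C" for n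
    using C[of n] by linarith
  moreover have "1 \<le> 1 + \<bar>q\<bar> + C" using C[of 0] by linarith
  ultimately show ?thesis by (rule that[rotated])
qed

text \<open>Both sides satisfy the same second-order recursion, forced by the partial sums of
  \<open>t\<close>, and they agree for n = 0 and n = 1.\<close>

lemma ar2_partial_sum:
  fixes x :: "int \<Rightarrow> real" and t :: "nat \<Rightarrow> real"
  assumes x0: "x (- 1) = 0" "x 0 = 0"
    and rec: "\<And>k. 1 \<le> k \<Longrightarrow> x (int k) = a * x (int k - 1) + b * x (int k - 2) + t k"
  shows "(\<Sum>k=1..n. x (int k)) = (\<Sum>k=1..n. step_response a b (n - k) * t k)"
proof -
  let ?P = "\<lambda>n. \<Sum>k=1..n. x (int k)"
  let ?W = "\<lambda>n. \<Sum>k=1..n. step_response a b (n - k) * t k"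
  have x1: "x 1 = t 1" using rec[of 1] x0 by simp
  have xS: "x (int (Suc (Suc k))) = a * x (int (Suc k)) + b * x (int k) + t (Suc (Suc k))" for k
    using rec[of "Suc (Suc k)"] by (simp add: algebra_simps)
  have P: "?P (Suc (Suc n)) = a * ?P (Suc n) + b * ?P n + (\<Sum>k=1..Suc (Suc n). t k)" for n
  proof (induction n)
    case 0
    show ?case using x1 xS[of 0] x0 by simp
  next
    case (Suc n)
    have "?P (Suc (Suc (Suc n))) = ?P (Suc (Suc n)) + x (int (Suc (Suc (Suc n))))" by simp
    also have "\<dots> = a * (?P (Suc n) + x (int (Suc (Suc n)))) + b * (?P n + x (int (Suc n)))
        + ((\<Sum>k=1..Suc (Suc n). t k) + t (Suc (Suc (Suc n))))"
      unfolding Suc.IH xS[of "Suc n"] by (simp add: algebra_simps)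
    finally show ?case by simp
  qed
  \<comment> \<open>For k \<le> n the recursion of the step response applies; the terms k = n + 1
    and k = n + 2 are matched by its initial values 1 + a and 1.\<close>
  have W: "?W (Suc (Suc n)) = a * ?W (Suc n) + b * ?W n + (\<Sum>k=1..Suc (Suc n). t k)" for n
  proof -
    have "(\<Sum>k=1..n. step_response a b (Suc (Suc n) - k) * t k) =
        (\<Sum>k=1..n. a * (step_response a b (Suc n - k) * t k) + b * (step_response a b (n - k) * t k) + t k)"
      by (intro sum.cong) (auto simp: Suc_diff_le algebra_simps)
    then show ?thesis
      by (simp add: sum.distrib sum_distrib_left Suc_diff_le algebra_simps)
  qed
  show ?thesis
  proof (induction n rule: induct_nat_012)
    case 1
    show ?case using x1 by simp
  next
    case (ge2 n)
    show ?case unfolding P W using ge2 by simp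
  qed simp
qed

subsection \<open>Complete convergence\<close>

theorem theorem1:
  fixes a b p r \<epsilon> :: real
    and M :: "'a measure" and N :: "'b measure"
    and \<theta> :: "'b \<Rightarrow> real"
    and \<theta>s :: "nat \<Rightarrow> 'a \<Rightarrow> real"
    and \<xi> :: "int \<Rightarrow> 'a \<Rightarrow> real"
    and S :: "nat \<Rightarrow> 'a \<Rightarrow> real"
  assumes b: "- 1 < b" "b < 1 - \<bar>a\<bar>"
    and p: "0 < p" "p < 2"
    and r: "r \<ge> p"
    and N: "prob_space N"
    and \<theta>: "\<theta> \<in> borel_measurable N"
    and M: "prob_space M"
    and indep: "prob_space.indep_vars M (\<lambda>_. borel) \<theta>s {1..}"
    and copies: "\<And>k. k \<ge> 1 \<Longrightarrow> distr M borel (\<theta>s k) = distr N borel \<theta>"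
    and \<xi>_init: "\<And>\<omega>. \<omega> \<in> space M \<Longrightarrow> \<xi> (- 1) \<omega> = 0"
      "\<And>\<omega>. \<omega> \<in> space M \<Longrightarrow> \<xi> 0 \<omega> = 0"
    and \<xi>_rec: "\<And>k \<omega>. k \<ge> 1 \<Longrightarrow> \<omega> \<in> space M \<Longrightarrow>
      \<xi> (int k) \<omega> = a * \<xi> (int k - 1) \<omega> + b * \<xi> (int k - 2) \<omega> + \<theta>s k \<omega>"
    and S: "\<And>n \<omega>. n \<ge> 1 \<Longrightarrow> \<omega> \<in> space M \<Longrightarrow> S n \<omega> = (\<Sum>k=1..n. \<xi> (int k) \<omega>)"
    and moment: "integrable N (\<lambda>x. \<bar>\<theta> x\<bar> powr r)"
    and mean: "r \<ge> 1 \<Longrightarrow> integral\<^sup>L N \<theta> = 0"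
    and \<epsilon>: "\<epsilon> > 0"
  shows "(\<lambda>n::nat. real n powr (r / p - 2) *
      measure M {\<omega> \<in> space M. \<bar>S n \<omega>\<bar> / real n powr (1 / p) > \<epsilon>}) summable_on {1..}"
proof -
  obtain C where C: "1 \<le> C" "\<And>n. \<bar>step_response a b n\<bar> \<le> C"
    using step_response_bounded[OF b] by blast
  define D where "D = distr N borel \<theta>"
  \<comment> \<open>Dividing by \<open>C\<close> normalises the weights; in return \<epsilon>
    becomes \<epsilon> / C.\<close>
  define c where "c n k = step_response a b (n - k) / C" for n k :: nat
  interpret M: prob_space M by (fact M)
  interpret D: prob_space D
    unfolding D_def using N \<theta> by (rule prob_space.prob_space_distr)
  interpret weighted_iid_sum M D \<theta>s c
  proof
    show "\<bar>c n k\<bar> \<le> 1" for n k using C by (simp add: c_def)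
  qed (use indep copies in \<open>auto simp: D_def\<close>)
  have int: "integrable D (\<lambda>x. \<bar>x\<bar> powr r)"
    unfolding D_def using moment \<theta> by (subst integrable_distr_eq) auto
  have mean': "1 \<le> r \<Longrightarrow> (\<integral>x. x \<partial>D) = 0"
    unfolding D_def using mean \<theta> by (subst integral_distr) auto
  let ?g = "\<lambda>n. real n powr (r / p - 2) *
    measure M {\<omega>\<in>space M. \<epsilon> / C * real n powr (1 / p) < \<bar>\<Sum>k=1..n. c n k * \<theta>s k \<omega>\<bar>}"
  have "summable ?g"
  proof (cases "r < 2")
    case True
    then show ?thesis
      using C \<epsilon> p r int mean' by (intro baum_katz_small_moment) auto
  next
    case False
    then show ?thesis
      using C \<epsilon> p int mean' by (intro baum_katz_large_moment) auto
  qed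
  \<comment> \<open>The terms are nonnegative, so convergence of the series is absolute and gives
    unconditional summability.\<close>
  then have "?g summable_on UNIV"
    by (intro norm_summable_imp_summable_on) simp
  then have "?g summable_on {1..}"
    by (rule summable_on_subset_banach) simp
  \<comment> \<open>The events are compared for n \<ge> 1 only, where n^(1/p) is positive and the
    division can be cleared.\<close>
  moreover have "{\<omega> \<in> space M. \<epsilon> < \<bar>S n \<omega>\<bar> / real n powr (1 / p)} =
      {\<omega>\<in>space M. \<epsilon> / C * real n powr (1 / p) < \<bar>\<Sum>k=1..n. c n k * \<theta>s k \<omega>\<bar>}" if n: "n \<in> {1..}" for n
  proof (intro Collect_cong conj_cong refl)
    fix \<omega> assume \<omega>: "\<omega> \<in> space M"
    have "S n \<omega> = (\<Sum>k=1..n. \<xi> (int k) \<omega>)"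
      using n \<omega> by (intro S) auto
    also have "\<dots> = (\<Sum>k=1..n. step_response a b (n - k) * \<theta>s k \<omega>)"
      using \<omega> by (intro ar2_partial_sum \<xi>_init \<xi>_rec)
    also have "\<dots> = C * (\<Sum>k=1..n. c n k * \<theta>s k \<omega>)"
      using C by (simp add: c_def sum_distrib_left)
    finally have "\<bar>S n \<omega>\<bar> = C * \<bar>\<Sum>k=1..n. c n k * \<theta>s k \<omega>\<bar>"
      using C by (simp add: abs_mult)
    then show "\<epsilon> < \<bar>S n \<omega>\<bar> / real n powr (1 / p) \<longleftrightarrow>
        \<epsilon> / C * real n powr (1 / p) < \<bar>\<Sum>k=1..n. c n k * \<theta>s k \<omega>\<bar>"
      using n C by (simp add: field_simps)
  qed
  ultimately show ?thesis
    by (subst summable_on_cong[where g = ?g]) (auto simp only:)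
qed

end
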